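(* Let $0<q<1$ and $a>0$. The dual alternative $q$-Charlier polynomials $d_n(\mu(m))\equiv d_n(\mu(m);a;q)$, where $\mu(m)=q^{-m}-aq^m$, satisfy the three-term recurrence relation $$(q^{-m}-a\,q^{m})\,d_n(\mu(m))=-a\,d_{n+1}(\mu(m))+q^{-n}\,d_n(\mu(m))-q^{-n}(1-q^n)\,d_{n-1}(\mu(m))$$ for all integers $m,n\ge 0$ (for $n=0$ the last term is absent, its coefficient being zero).
   Context: Notation: $(x;q)_k=\prod_{j=0}^{k-1}(1-xq^j)$. The dual alternative $q$-Charlier polynomials are the polynomials of degree $n$ in $\mu(m):=q^{-m}-a\,q^{m}$ given by $$d_n(\mu(m);a;q):={}_3\phi_0\bigl(q^{-m},-a\,q^{m},q^{-n};\,-\,;\,q,-q^n/a\bigr)=\sum_{k=0}^{n}\frac{(q^{-m};q)_k(-aq^m;q)_k(q^{-n};q)_k}{(q;q)_k}\,q^{-k(k-1)}\,(-q^n/a)^k .$$ *)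

theory Defs
  imports Complex_Main
begin

definition qpochhammer :: "real \<Rightarrow> real \<Rightarrow> nat \<Rightarrow> real" where
  "qpochhammer x q k = (\<Prod>j<k. 1 - x * q ^ j)"

definition mu :: "real \<Rightarrow> real \<Rightarrow> nat \<Rightarrow> real" where
  "mu a q m = q powi (- int m) - a * q ^ m"

text \<open>
  The value at \<open>mu a q m\<close> of the dual alternative \<open>q\<close>-Charlier polynomial of degree \<open>n\<close>,
  as the terminating series \<open>3phi0(q^(-m), -a q^m, q^(-n); - ; q, -q^n/a)\<close>; the factor
  \<open>q^(-k(k-1))\<close> is \<open>((-1)^k q^(k(k-1)/2))^(1+s-r)\<close> for \<open>r = 3\<close>, \<open>s = 0\<close>.
\<close>
definition dual_alt_q_charlier :: "real \<Rightarrow> real \<Rightarrow> nat \<Rightarrow> nat \<Rightarrow> real" where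
  "dual_alt_q_charlier a q n m =
     (\<Sum>k=0..n. qpochhammer (q powi (- int m)) q k * qpochhammer (- a * q ^ m) q k
                * qpochhammer (q powi (- int n)) q k / qpochhammer q q k
                * q powi (- (int k * (int k - 1))) * (- (q ^ n) / a) ^ k)"

end

theory Submission
  imports Defs
begin

text \<open>
  Put \<open>P k = (q^(-m);q)_k (-a q^m;q)_k\<close>. Then \<open>P (k+1) = (1 - a q^(2k) - q^k mu) P k\<close>, and
  \<open>d_n\<close> is the sum of \<open>c k * P k\<close>, where \<open>c k\<close> is a product of ratios rational in \<open>x = q^n\<close>.
  With \<open>c\<close> at \<open>q x\<close> and \<open>x / q\<close> expressed through \<open>c\<close> at \<open>x\<close>, the difference of the two sides
  of the recurrence telescopes, its partial sum up to \<open>N\<close> being \<open>- c N P (N+1) / q^N\<close>.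
  This vanishes for \<open>N > n\<close>.
\<close>

text \<open>A free real \<open>x\<close> in place of \<open>q ^ n\<close> turns the changes of
  degree into \<open>q * x\<close> and \<open>x / q\<close>. The powers \<open>q ^ (2 * j)\<close>
  multiply up to the factor q^(k(k-1)) of the series.\<close>

definition charlier_coeff :: "real \<Rightarrow> real \<Rightarrow> real \<Rightarrow> nat \<Rightarrow> real" where
  "charlier_coeff a q x k = (\<Prod>j<k. (q ^ j - x) / ((1 - q ^ Suc j) * q ^ (2 * j) * a))"

definition charlier_basis :: "real \<Rightarrow> real \<Rightarrow> nat \<Rightarrow> nat \<Rightarrow> real" where
  "charlier_basis a q m k = qpochhammer (q powi (- int m)) q k * qpochhammer (- a * q ^ m) q k"

lemma qpochhammer_Suc: "qpochhammer x q (Suc k) = qpochhammer x q k * (1 - x * q ^ k)"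
  by (simp add: qpochhammer_def)

lemma charlier_coeff_0 [simp]: "charlier_coeff a q x 0 = 1"
  by (simp add: charlier_coeff_def)

lemma charlier_coeff_Suc:
  "charlier_coeff a q x (Suc k) =
     charlier_coeff a q x k * ((q ^ k - x) / ((1 - q ^ Suc k) * q ^ (2 * k) * a))"
  by (simp add: charlier_coeff_def)

lemma charlier_coeff_eq_0: "n < k \<Longrightarrow> charlier_coeff a q (q ^ n) k = 0"
  by (auto simp: charlier_coeff_def)

lemma charlier_basis_0 [simp]: "charlier_basis a q m 0 = 1"
  by (simp add: charlier_basis_def qpochhammer_def)

text \<open>The two Pochhammer arguments have sum \<open>mu a q m\<close> and product -a, so the new
  quadratic factor depends on \<open>m\<close> only through \<open>mu\<close>.\<close>

lemma charlier_basis_Suc: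
  assumes "q \<noteq> 0"
  shows "charlier_basis a q m (Suc k) =
           charlier_basis a q m k * (1 - a * (q ^ k)\<^sup>2 - q ^ k * mu a q m)"
proof -
  have "(1 - q powi (- int m) * q ^ k) * (1 - - a * q ^ m * q ^ k)
          = 1 - a * (q ^ k)\<^sup>2 - q ^ k * mu a q m"
    using assms by (simp add: mu_def power_int_minus field_simps power2_eq_square)
  from this [symmetric] show ?thesis
    by (simp only: charlier_basis_def qpochhammer_Suc mult_ac)
qed

text \<open>For j > 0 the numerator q^j - q x is q (q^(j-1) - x), so the numerators shift by one
  index and leave q^k and the factor 1 - q x of j = 0. Index \<open>k\<close> on the right avoids
  dividing by \<open>q ^ k - x\<close>, which is zero at x = q^k.\<close>

lemma charlier_coeff_mult_q:
  assumes "0 < q" "q < 1" "a \<noteq> 0"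
  shows "charlier_coeff a q (q * x) (Suc k) =
           charlier_coeff a q x k * (q ^ k * (1 - q * x) / ((1 - q ^ Suc k) * q ^ (2 * k) * a))"
proof (induction k)
  case 0
  show ?case by (simp add: charlier_coeff_Suc)
next
  case (Suc k)
  have "charlier_coeff a q (q * x) (Suc (Suc k)) =
      charlier_coeff a q x k * (q ^ k * (1 - q * x) / ((1 - q ^ Suc k) * q ^ (2 * k) * a))
      * ((q ^ Suc k - q * x) / ((1 - q ^ Suc (Suc k)) * q ^ (2 * Suc k) * a))"
    by (subst charlier_coeff_Suc, subst Suc) (rule refl)
  also have "\<dots> = charlier_coeff a q x k * ((q ^ k - x) / ((1 - q ^ Suc k) * q ^ (2 * k) * a))
      * (q ^ Suc k * (1 - q * x) / ((1 - q ^ Suc (Suc k)) * q ^ (2 * Suc k) * a))"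
  proof -
    have "q ^ k * (1 - q * x) * (q ^ Suc k - q * x) = (q ^ k - x) * (q ^ Suc k * (1 - q * x))"
      by (simp add: algebra_simps)
    then show ?thesis by (simp only: times_divide_times_eq mult.assoc)
  qed
  finally show ?case by (simp only: charlier_coeff_Suc)
qed

text \<open>Here the numerators shift the other way: 1 - x supplies the missing first one, and q^k -
  x is left over. Keeping 1 - x as a factor covers x = 1; it is the coefficient 1 - q^n of the
  recurrence.\<close>

lemma charlier_coeff_divide_q:
  assumes "0 < q"
  shows "(1 - x) * charlier_coeff a q (x / q) k = (1 - x / q ^ k) * charlier_coeff a q x k"
proof (induction k)
  case 0
  show ?case by simp
next
  case (Suc k)
  define D where "D = (1 - q ^ Suc k) * q ^ (2 * k) * a"
  have "(1 - x) * charlier_coeff a q (x / q) (Suc k)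
          = (1 - x / q ^ k) * charlier_coeff a q x k * ((q ^ k - x / q) / D)"
    using Suc by (simp add: charlier_coeff_Suc D_def)
  also have "\<dots> = ((1 - x / q ^ k) * (q ^ k - x / q)) * charlier_coeff a q x k / D"
    by simp
  also have "(1 - x / q ^ k) * (q ^ k - x / q) = (1 - x / q ^ Suc k) * (q ^ k - x)"
    using assms by (simp add: field_simps)
  finally show ?case by (simp add: charlier_coeff_Suc D_def mult_ac)
qed

lemma charlier_coeff_power:
  assumes "0 < q" "q < 1" "a \<noteq> 0"
  shows "qpochhammer (q powi (- int n)) q k / qpochhammer q q k
           * q powi (- (int k * (int k - 1))) * (- (q ^ n) / a) ^ k = charlier_coeff a q (q ^ n) k"
proof (induction k)
  case 0
  show ?case by (simp add: qpochhammer_def)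
next
  case (Suc k)
  have exponent: "- (int (Suc k) * (int (Suc k) - 1)) = - (int k * (int k - 1)) - int (2 * k)"
    by (simp add: algebra_simps)
  have pow: "q powi (- (int (Suc k) * (int (Suc k) - 1)))
        = q powi (- (int k * (int k - 1))) / q ^ (2 * k)"
    unfolding exponent using assms by (subst power_int_diff) (simp_all only: power_int_of_nat, simp)
  \<comment> \<open>One factor -q^n/a is spent on each Pochhammer factor, which clears the negative
    power of \<open>q\<close>.\<close>
  have ratio: "(1 - q powi (- int n) * q ^ k) * (- (q ^ n) / a) = (q ^ k - q ^ n) / a"
    using assms by (simp add: power_int_minus field_simps)
  have "qpochhammer (q powi (- int n)) q (Suc k) / qpochhammer q q (Suc k)
      * q powi (- (int (Suc k) * (int (Suc k) - 1))) * (- (q ^ n) / a) ^ Suc k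
    = (qpochhammer (q powi (- int n)) q k / qpochhammer q q k
      * q powi (- (int k * (int k - 1))) * (- (q ^ n) / a) ^ k)
      * (((1 - q powi (- int n) * q ^ k) * (- (q ^ n) / a)) / ((1 - q ^ Suc k) * q ^ (2 * k)))"
    unfolding pow qpochhammer_Suc power_Suc
    by (simp only: times_divide_times_eq times_divide_eq_left times_divide_eq_right
        divide_divide_eq_left mult_ac)
  also have "\<dots> = charlier_coeff a q (q ^ n) (Suc k)"
    unfolding ratio Suc charlier_coeff_Suc by (simp add: mult_ac)
  finally show ?case .
qed

text \<open>The free upper limit lets the three degrees of the recurrence share one index
  range.\<close>

lemma dual_alt_q_charlier_eq_sum:
  assumes "0 < q" "q < 1" "a \<noteq> 0" "n \<le> N"
  shows "dual_alt_q_charlier a q n m =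
           (\<Sum>k\<le>N. charlier_coeff a q (q ^ n) k * charlier_basis a q m k)"
proof -
  have "dual_alt_q_charlier a q n m =
          (\<Sum>k\<le>n. charlier_coeff a q (q ^ n) k * charlier_basis a q m k)"
    unfolding dual_alt_q_charlier_def atMost_atLeast0
    by (intro sum.cong refl, subst charlier_coeff_power [OF assms(1-3), symmetric])
      (simp add: charlier_basis_def)
  also have "\<dots> = (\<Sum>k\<le>N. charlier_coeff a q (q ^ n) k * charlier_basis a q m k)"
    using assms by (intro sum.mono_neutral_left) (auto simp: charlier_coeff_eq_0)
  finally show ?thesis .
qed

text \<open>Solving the recursion of P for mu P k, the term mu c k P k yields the new boundary term
  -c k P (k+1) / q^k. What remains at P k has coefficient a (c' k - q^k c k), with c' taken at q x;
  for k > 0 this equals c (k-1) / q^(k-1) and cancels the previous boundary term.\<close>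

lemma charlier_recurrence_partial_sum:
  assumes "0 < q" "q < 1" "a \<noteq> 0" "x \<noteq> 0"
  shows "(\<Sum>k\<le>N. (mu a q m * charlier_coeff a q x k + a * charlier_coeff a q (q * x) k
             - charlier_coeff a q x k / x + (1 - x / q ^ k) * charlier_coeff a q x k / x)
             * charlier_basis a q m k)
         = - charlier_coeff a q x N * charlier_basis a q m (Suc N) / q ^ N"
proof (induction N)
  case 0
  show ?case using assms by (simp add: charlier_basis_Suc field_simps)
next
  case (Suc N)
  define y c M where "y = q ^ N" and "c = charlier_coeff a q x N" and "M = mu a q m"
  \<comment> \<open>P (N+1) is common to the old boundary term and the new summand, so it can be
    divided out.\<close>
  define B where "B = charlier_basis a q m (Suc N)"
  have nz: "y \<noteq> 0" "1 - q * y \<noteq> 0" "q \<noteq> 0"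
    using assms power_Suc_less_one [of q N] by (auto simp: y_def)
  have dbl: "q ^ (2 * N) = y * y"
    by (simp add: y_def mult_2 power_add)
  have c1: "charlier_coeff a q x (Suc N) = c * ((y - x) / ((1 - q * y) * (y * y) * a))"
    by (simp add: charlier_coeff_Suc c_def dbl) (simp add: y_def)
  have c2: "charlier_coeff a q (q * x) (Suc N)
      = c * (y * (1 - q * x) / ((1 - q * y) * (y * y) * a))"
    by (subst charlier_coeff_mult_q [OF assms(1-3)]) (simp add: c_def dbl, simp add: y_def)
  have B2: "charlier_basis a q m (Suc (Suc N)) = B * (1 - a * (q * y)\<^sup>2 - q * y * M)"
    using charlier_basis_Suc [OF nz(3), of a m "Suc N"] by (simp add: B_def y_def M_def)
  define D where "D = (1 - q * y) * (y * y) * a"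
  \<comment> \<open>Over the common denominator \<open>D\<close> the factor \<open>c / D\<close>
    splits off, and only the identity \<open>poly\<close> remains.\<close>
  have cy: "- c / y = - c * (1 - q * y) * y * a / D"
    using nz assms by (simp add: D_def)
  have poly: "M * (y - x) + a * (y * (1 - q * x)) - (y - x) / x + (1 - x / (q * y)) * (y - x) / x
      - (1 - q * y) * y * a = - (y - x) * (1 - a * (q * y)\<^sup>2 - q * y * M) / (q * y)"
    using nz assms by (simp add: field_simps power2_eq_square)
  have key: "- c / y + (M * (c * ((y - x) / D)) + a * (c * (y * (1 - q * x) / D))
      - c * ((y - x) / D) / x + (1 - x / (q * y)) * (c * ((y - x) / D)) / x)
      = - (c * ((y - x) / D)) * (1 - a * (q * y)\<^sup>2 - q * y * M) / (q * y)"
    (is "?L1 + ?L2 = ?R")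
  proof -
    have "?L1 + ?L2 = c / D * (M * (y - x) + a * (y * (1 - q * x)) - (y - x) / x
        + (1 - x / (q * y)) * (y - x) / x - (1 - q * y) * y * a)"
      unfolding cy by (simp add: diff_divide_distrib add_divide_distrib right_diff_distrib
          distrib_left mult_ac)
    also have "\<dots> = ?R" unfolding poly by (simp del: minus_diff_eq)
    finally show ?thesis .
  qed
  show ?case
    unfolding sum.atMost_Suc Suc B2 c1 c2
    unfolding D_def [symmetric] c_def [symmetric] B_def [symmetric] M_def [symmetric]
      y_def [symmetric] power_Suc
    using arg_cong [OF key, of "\<lambda>t. t * B"]
    by (simp only: distrib_left times_divide_eq_left times_divide_eq_right mult_ac)
qed

(* For n = 0 the truncated index n - 1 is harmless: its coefficient 1 - q ^ 0 vanishes. *)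
theorem mainTheorem3:
  fixes a q :: real and m n :: nat
  assumes "0 < q" and "q < 1" and "a > 0"
  shows "mu a q m * dual_alt_q_charlier a q n m =
           - a * dual_alt_q_charlier a q (n + 1) m
           + q powi (- int n) * dual_alt_q_charlier a q n m
           - q powi (- int n) * (1 - q ^ n) * dual_alt_q_charlier a q (n - 1) m"
proof -
  define x where "x = q ^ n"
  define c B where "c = charlier_coeff a q x" and "B = charlier_basis a q m"
  have a: "a \<noteq> 0" and x: "x \<noteq> 0" using assms by (simp_all add: x_def)
  have inv: "q powi (- int n) = 1 / x"
    by (simp add: x_def power_int_minus divide_inverse)
  \<comment> \<open>The limit n + 1 is the largest degree involved, and the coefficient of degree n
    already vanishes there, which kills the boundary term.\<close>
  have d: "dual_alt_q_charlier a q n m = (\<Sum>k\<le>n + 1. c k * B k)"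
    unfolding c_def B_def x_def using assms a by (intro dual_alt_q_charlier_eq_sum) auto
  have d_next: "dual_alt_q_charlier a q (n + 1) m
      = (\<Sum>k\<le>n + 1. charlier_coeff a q (q * x) k * B k)"
    using dual_alt_q_charlier_eq_sum [OF assms(1,2) a, of "n + 1" "n + 1" m]
    by (simp add: B_def x_def)
  have lower: "(1 - x) * charlier_coeff a q (q ^ (n - 1)) k = (1 - x / q ^ k) * c k" for k
  proof (cases n)
    \<comment> \<open>Here \<open>q ^ (n - 1)\<close> is 1, not \<open>x / q\<close>. The left side
      vanishes since x = 1; the right side vanishes through 1 - x / q^k at k = 0 and through
      \<open>c k\<close> for k > 0.\<close>
    case 0
    then show ?thesis
      by (cases k) (simp_all add: x_def c_def charlier_coeff_eq_0 [of 0, simplified])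
  next
    case (Suc i)
    then have "q ^ (n - 1) = x / q" using assms by (simp add: x_def)
    then show ?thesis using charlier_coeff_divide_q [OF assms(1)] by (simp add: c_def)
  qed
  have "(1 - x) * dual_alt_q_charlier a q (n - 1) m
      = (\<Sum>k\<le>n + 1. (1 - x) * charlier_coeff a q (q ^ (n - 1)) k * B k)"
    using dual_alt_q_charlier_eq_sum [OF assms(1,2) a, of "n - 1" "n + 1" m]
    by (simp only: B_def sum_distrib_left mult.assoc)
  then have d_prev: "(1 - x) * dual_alt_q_charlier a q (n - 1) m
      = (\<Sum>k\<le>n + 1. (1 - x / q ^ k) * c k * B k)"
    by (simp only: lower)
  have "(\<Sum>k\<le>n + 1. (mu a q m * c k + a * charlier_coeff a q (q * x) k
          - c k / x + (1 - x / q ^ k) * c k / x) * B k) = 0"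
    unfolding c_def B_def charlier_recurrence_partial_sum [OF assms(1,2) a x]
    by (simp add: x_def charlier_coeff_eq_0)
  moreover have "(\<Sum>k\<le>n + 1. (mu a q m * c k + a * charlier_coeff a q (q * x) k
          - c k / x + (1 - x / q ^ k) * c k / x) * B k)
      = mu a q m * dual_alt_q_charlier a q n m + a * dual_alt_q_charlier a q (n + 1) m
        - dual_alt_q_charlier a q n m / x + (1 - x) * dual_alt_q_charlier a q (n - 1) m / x"
    unfolding d d_next d_prev sum_distrib_left sum_divide_distrib sum.distrib [symmetric]
      sum_subtractf [symmetric]
    by (intro sum.cong refl) (simp only: distrib_right left_diff_distrib times_divide_eq_left mult.assoc)
  ultimately show ?thesis
    unfolding inv x_def [symmetric] by simp
qed

end
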